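(* Let $D$ be a 2-arc-strong digraph and let $u$ be a vertex of $D$. Suppose that $S$ is a semicomplete induced subdigraph of $D$ containing $u$. If every vertex of $D-V(S)$ has at least two in-neighbours and at least two out-neighbours in $V(S)$, then $D$ has a good $(u,u)$-pair.
   Context: Digraphs have no loops and no parallel arcs. A digraph is semicomplete if every two distinct vertices are joined by at least one arc. A digraph is strong if there is a directed path between every ordered pair of distinct vertices; it is $k$-arc-strong if it stays strong after deleting any at most $k-1$ arcs. An out-branching (resp. in-branching) rooted at $r$ is a spanning oriented tree in which every vertex except $r$ has in-degree (resp. out-degree) exactly one. A good $(u,v)$-pair is an out-branching rooted at $u$ and an in-branching rooted at $v$ that are arc-disjoint. *)

theory Defs
  imports "Graph_Theory.Graph_Theory"
begin

text \<open>
  A digraph (finite, without loops and parallel arcs) is an instance of the locale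
  \<^locale>\<open>digraph\<close>.
\<close>

definition semicomplete :: "('a, 'b) pre_digraph \<Rightarrow> bool" where
  "semicomplete D \<longleftrightarrow>
     (\<forall>x \<in> verts D. \<forall>y \<in> verts D. x \<noteq> y \<longrightarrow> x \<rightarrow>\<^bsub>D\<^esub> y \<or> y \<rightarrow>\<^bsub>D\<^esub> x)"

definition delete_arcs :: "('a, 'b) pre_digraph \<Rightarrow> 'b set \<Rightarrow> ('a, 'b) pre_digraph" where
  "delete_arcs D F = D\<lparr> arcs := arcs D - F \<rparr>"

text \<open>
  The bound is written \<open>card F < k\<close> rather than \<open>card F \<le> k - 1\<close> to avoid truncated subtraction;
  the notion is meant for \<open>k \<ge> 1\<close>.
\<close>

definition arc_strong :: "nat \<Rightarrow> ('a, 'b) pre_digraph \<Rightarrow> bool" where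
  "arc_strong k D \<longleftrightarrow>
     (\<forall>F. F \<subseteq> arcs D \<and> finite F \<and> card F < k \<longrightarrow> strongly_connected (delete_arcs D F))"

definition in_neighbours :: "('a, 'b) pre_digraph \<Rightarrow> 'a \<Rightarrow> 'a set" where
  "in_neighbours D v = {w \<in> verts D. w \<rightarrow>\<^bsub>D\<^esub> v}"

definition out_neighbours :: "('a, 'b) pre_digraph \<Rightarrow> 'a \<Rightarrow> 'a set" where
  "out_neighbours D v = {w \<in> verts D. v \<rightarrow>\<^bsub>D\<^esub> w}"

text \<open>
  An oriented tree is a digraph without directed 2-cycles whose underlying undirected graph is a
  tree.  The library's \<^const>\<open>tree\<close> is not suitable here: on a digraph that is not symmetric it only
  excludes directed cycles, so that every transitive tournament would be a tree.  Cycles of the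
  underlying graph are the cycles of length at least 3 of its symmetric closure
  \<^const>\<open>mk_symmetric\<close>; those of length 2 merely traverse one edge back and forth.
\<close>

definition oriented_tree :: "('a, 'b) pre_digraph \<Rightarrow> bool" where
  "oriented_tree T \<longleftrightarrow>
     digraph T \<and>
     (\<forall>x y. x \<rightarrow>\<^bsub>T\<^esub> y \<longrightarrow> \<not> y \<rightarrow>\<^bsub>T\<^esub> x) \<and>
     Digraph_Component.connected T \<and>
     \<not> (\<exists>p. 3 \<le> length p \<and> pre_digraph.cycle (with_proj (mk_symmetric T)) p)"

definition out_branching :: "('a, 'b) pre_digraph \<Rightarrow> 'a \<Rightarrow> ('a, 'b) pre_digraph \<Rightarrow> bool" where
  "out_branching D r B \<longleftrightarrow>
     spanning B D \<and> oriented_tree B \<and> r \<in> verts B \<and>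
     (\<forall>x \<in> verts B - {r}. in_degree B x = 1)"

definition in_branching :: "('a, 'b) pre_digraph \<Rightarrow> 'a \<Rightarrow> ('a, 'b) pre_digraph \<Rightarrow> bool" where
  "in_branching D r B \<longleftrightarrow>
     spanning B D \<and> oriented_tree B \<and> r \<in> verts B \<and>
     (\<forall>x \<in> verts B - {r}. out_degree B x = 1)"

definition has_good_pair :: "('a, 'b) pre_digraph \<Rightarrow> 'a \<Rightarrow> 'a \<Rightarrow> bool" where
  "has_good_pair D u v \<longleftrightarrow>
     (\<exists>B\<^sub>o B\<^sub>i. out_branching D u B\<^sub>o \<and> in_branching D v B\<^sub>i \<and> arcs B\<^sub>o \<inter> arcs B\<^sub>i = {})"

end

theory Submission
  imports Defs
begin

text \<open>
  Split \<open>V(S) - u\<close> into the out-neighbours \<open>O\<close> of \<open>u\<close> and the rest \<open>I\<close>, which consists of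
  in-neighbours of \<open>u\<close>.  As \<open>S\<close> is semicomplete, some \<open>x \<in> O\<close> is reachable inside \<open>O\<close> from all of
  \<open>O\<close>, and some \<open>y \<in> I\<close> reaches all of \<open>I\<close> inside \<open>I\<close>.  By 2-arc-strength there are arc-disjoint
  paths \<open>P\<close> from \<open>x\<close> to \<open>y\<close> and \<open>Q\<close> from \<open>x\<close> to \<open>u\<close>.  Cut \<open>P\<close> down to its part after the last vertex in
  \<open>O \<union> {u}\<close> and \<open>Q\<close> down to its part before the first vertex in \<open>I \<union> {u}\<close>.  Then the arcs \<open>u \<rightarrow> O\<close>, \<open>P\<close> and
  the arcs inside \<open>I\<close> span \<open>S\<close> from \<open>u\<close>, the arcs \<open>I \<rightarrow> u\<close>, \<open>Q\<close> and the arcs inside \<open>O\<close> span \<open>S\<close>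
  towards \<open>u\<close>, and these two arc sets are disjoint.  A vertex outside \<open>S\<close> missed by one of them is
  attached as a leaf by an arc from (or to) \<open>S\<close>; since the other path uses at most one arc into (or out of)
  it, one of the two available arcs is free.
\<close>

section \<open>Vertex walks and net flow out of a set\<close>

text \<open>The set \<open>F\<close> is read as a flow of value one on each of its arcs. Arcs with
  both ends in \<open>R\<close> cancel, so this is the outflow minus the inflow of
  \<open>R\<close>.\<close>

definition net :: "('a \<times> 'a) set \<Rightarrow> 'a set \<Rightarrow> int" where
  "net F R = (\<Sum>e\<in>F. of_bool (fst e \<in> R) - of_bool (snd e \<in> R))"

lemma vwalk_arcs_append_subset: "set (vwalk_arcs q) \<subseteq> set (vwalk_arcs (p @ q))"
proof (induction p)
  case (Cons a p)
  then show ?case by (cases "p @ q") auto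
qed simp

lemma vwalk_arcs_prefix_subset: "set (vwalk_arcs p) \<subseteq> set (vwalk_arcs (p @ q))"
proof (induction p rule: vwalk_arcs.induct)
  case (2 x)
  then show ?case by simp
qed auto

text \<open>The bounds \<open>butlast\<close> and \<open>tl\<close> are sharper than
  \<open>set p\<close>: the last vertex of a distinct walk is never a tail and its first vertex
  never a head. Truncated paths later use exactly this at their cut end.\<close>

lemma vwalk_arcs_ends:
  "(a, b) \<in> set (vwalk_arcs p) \<Longrightarrow> a \<in> set (butlast p) \<and> b \<in> set (tl p)"
proof (induction p rule: vwalk_arcs.induct)
  case (3 x y xs)
  then show ?case by (cases xs) (auto split: if_splits)
qed auto

lemma vwalk_arcs_unique_in:
  "\<lbrakk>distinct p; (a, c) \<in> set (vwalk_arcs p); (b, c) \<in> set (vwalk_arcs p)\<rbrakk> \<Longrightarrow> a = b"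
proof (induction p rule: vwalk_arcs.induct)
  case (3 x y xs)
  then show ?case by (auto dest: vwalk_arcs_ends)
qed auto

lemma vwalk_arcs_unique_out:
  "\<lbrakk>distinct p; (c, a) \<in> set (vwalk_arcs p); (c, b) \<in> set (vwalk_arcs p)\<rbrakk> \<Longrightarrow> a = b"
proof (induction p rule: vwalk_arcs.induct)
  case (3 x y xs)
  have "c \<noteq> x" if "(c, d) \<in> set (vwalk_arcs (y # xs))" for d
    using vwalk_arcs_ends[OF that] in_set_butlastD[of c "y # xs"] 3(2) by auto
  with 3 show ?case by auto
qed auto

lemma rtrancl_hd_vwalk:
  "\<lbrakk>set (vwalk_arcs p) \<subseteq> X; v \<in> set p\<rbrakk> \<Longrightarrow> (hd p, v) \<in> X\<^sup>*"
proof (induction p rule: vwalk_arcs.induct)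
  case (3 x y xs)
  show ?case
  proof (cases "v = x")
    case False
    then have "(y, v) \<in> X\<^sup>*" using 3 by auto
    then show ?thesis using 3(2) by (auto intro: converse_rtrancl_into_rtrancl)
  qed auto
qed auto

lemma rtrancl_vwalk_last:
  "\<lbrakk>set (vwalk_arcs p) \<subseteq> X; v \<in> set p\<rbrakk> \<Longrightarrow> (v, last p) \<in> X\<^sup>*"
proof (induction p arbitrary: v rule: vwalk_arcs.induct)
  case (3 x y xs)
  have "(y, last (y # xs)) \<in> X\<^sup>*" using 3(1)[of y] 3(2) by auto
  moreover have "(x, y) \<in> X" using 3(2) by auto
  ultimately show ?case using 3 by (auto intro: converse_rtrancl_into_rtrancl)
qed auto

lemma rtrancl_distinct_vwalk:
  assumes "(x, y) \<in> X\<^sup>*"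
  shows "\<exists>p. p \<noteq> [] \<and> hd p = x \<and> last p = y \<and> distinct p \<and> set (vwalk_arcs p) \<subseteq> X"
  using assms
proof (induction rule: converse_rtrancl_induct)
  case base
  show ?case by (intro exI[of _ "[y]"]) auto
next
  case (step x z)
  then obtain p where p: "p \<noteq> []" "hd p = z" "last p = y" "distinct p" "set (vwalk_arcs p) \<subseteq> X"
    by blast
  show ?case
  proof (cases "x \<in> set p")
    case True
    \<comment> \<open>If \<open>x\<close> already lies on the path, the suffix starting at
      \<open>x\<close> is a shortcut.\<close>
    then obtain q r where "p = q @ x # r" by (meson split_list)
    with p show ?thesis
      using vwalk_arcs_append_subset[of "x # r" q] by (intro exI[of _ "x # r"]) auto
  next
    case False
    with p step(1) show ?thesis
      by (intro exI[of _ "x # p"]) (cases p; auto)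
  qed
qed

text \<open>The sum telescopes along the walk. Distinctness ensures that no arc repeats, so passing
  to the set of arcs loses nothing.\<close>

lemma net_vwalk:
  "\<lbrakk>distinct p; p \<noteq> []\<rbrakk> \<Longrightarrow>
    net (set (vwalk_arcs p)) R = of_bool (hd p \<in> R) - of_bool (last p \<in> R)"
proof (induction p rule: vwalk_arcs.induct)
  case (3 x y xs)
  have "(x, y) \<notin> set (vwalk_arcs (y # xs))"
    using vwalk_arcs_ends[of x y "y # xs"] in_set_butlastD[of x "y # xs"] 3(2) by auto
  with 3 show ?case by (simp add: net_def)
qed (auto simp: net_def)

text \<open>Used contrapositively: positive net outflow forces an arc out of \<open>R\<close>, which
  turns flow into reachability.\<close>

lemma net_nonpos_if_closed:
  assumes "finite F" and "\<And>a b. \<lbrakk>(a, b) \<in> F; a \<in> R\<rbrakk> \<Longrightarrow> b \<in> R"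
  shows "net F R \<le> 0"
  unfolding net_def by (rule sum_nonpos) (use assms(2) in \<open>auto simp: of_bool_def\<close>)

text \<open>The equality case of weak duality between flows and cuts: with nothing flowing in, only
  the leaving arcs contribute, one each.\<close>

lemma net_saturated_cut:
  assumes "finite F" "E \<inter> R \<times> (- R) \<subseteq> F" "F \<subseteq> E" "F \<inter> (- R) \<times> R = {}"
  shows "net F R = int (card (E \<inter> R \<times> (- R)))"
proof -
  let ?L = "E \<inter> R \<times> (- R)"
  have "net F R = (\<Sum>e\<in>?L. of_bool (fst e \<in> R) - of_bool (snd e \<in> R))"
    unfolding net_def using assms by (intro sum.mono_neutral_right) auto
  also have "\<dots> = (\<Sum>e\<in>?L. 1)" by (rule sum.cong) auto
  finally show ?thesis by simp
qed

section \<open>Augmenting paths and two arc-disjoint paths\<close>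

lemma augment_along_vwalk:
  assumes "finite E" "F \<subseteq> E" "distinct p" "p \<noteq> []"
    and "set (vwalk_arcs p) \<subseteq> (E - F) \<union> F\<inverse>"
  shows "\<exists>F' \<subseteq> E. (\<forall>R. net F' R = net F R + of_bool (hd p \<in> R) - of_bool (last p \<in> R)) \<and>
           (\<forall>a b. \<not> {a, b} \<subseteq> set p \<longrightarrow> (a, b) \<in> F' \<longleftrightarrow> (a, b) \<in> F)"
  using assms(3-)
proof (induction p rule: vwalk_arcs.induct)
  case (2 x)
  then show ?case using assms(2) by (intro exI[of _ F]) auto
next
  case (3 x y xs)
  then have "\<exists>F' \<subseteq> E. (\<forall>R. net F' R = net F R + of_bool (hd (y # xs) \<in> R) -
      of_bool (last (y # xs) \<in> R)) \<and>
      (\<forall>a b. \<not> {a, b} \<subseteq> set (y # xs) \<longrightarrow> (a, b) \<in> F' \<longleftrightarrow> (a, b) \<in> F)"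
    by (intro 3(1)) auto
  then obtain F' where F': "F' \<subseteq> E"
      "\<And>R. net F' R = net F R + of_bool (y \<in> R) - of_bool (last (y # xs) \<in> R)"
      "\<And>a b. \<not> {a, b} \<subseteq> set (y # xs) \<Longrightarrow> (a, b) \<in> F' \<longleftrightarrow> (a, b) \<in> F"
    by (metis list.sel(1))
  have fin: "finite F'" using F'(1) assms(1) finite_subset by blast
  have x: "x \<notin> set (y # xs)" using 3 by auto
  have same: "(x, y) \<in> F' \<longleftrightarrow> (x, y) \<in> F" "(y, x) \<in> F' \<longleftrightarrow> (y, x) \<in> F"
    using F'(3) x by auto
  consider "(x, y) \<in> E" "(x, y) \<notin> F" | "(y, x) \<in> F" using 3(3,4) by auto
  then show ?case
  proof cases
    case 1
    then have "net (insert (x, y) F') R = net F' R + of_bool (x \<in> R) - of_bool (y \<in> R)" for R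
      using fin same by (simp add: net_def)
    with 1 F' show ?thesis by (intro exI[of _ "insert (x, y) F'"]) auto
  next
    case 2
    then have "net (F' - {(y, x)}) R = net F' R + of_bool (x \<in> R) - of_bool (y \<in> R)" for R
      using fin same by (simp add: net_def sum_diff1)
    with 2 F' show ?thesis by (intro exI[of _ "F' - {(y, x)}"]) auto
  qed
qed auto

text \<open>If \<open>y\<close> were not residually reachable from \<open>x\<close>, the reachable
  set would be a saturated cut, contradicting \<open>small\<close>. The bound on \<open>R\<close> in
  \<open>small\<close> keeps the tested sets inside the vertex set of the intended
  application.\<close>

lemma augment:
  assumes "finite E" "F \<subseteq> E"
    and small: "\<And>R. \<lbrakk>x \<in> R; y \<notin> R; R \<subseteq> insert x (Range E \<union> Domain E)\<rbrakk> \<Longrightarrow>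
      net F R < int (card (E \<inter> R \<times> (- R)))"
  shows "\<exists>F' \<subseteq> E. \<forall>R. net F' R = net F R + of_bool (x \<in> R) - of_bool (y \<in> R)"
proof -
  let ?X = "(E - F) \<union> F\<inverse>"
  let ?R = "?X\<^sup>* `` {x}"
  have "(x, y) \<in> ?X\<^sup>*"
  proof (rule ccontr)
    assume "(x, y) \<notin> ?X\<^sup>*"
    moreover have "?R \<subseteq> insert x (Range E \<union> Domain E)"
    proof
      fix v assume "v \<in> ?R"
      then have "(x, v) \<in> ?X\<^sup>*" by simp
      then show "v \<in> insert x (Range E \<union> Domain E)" using assms(2) by cases auto
    qed
    ultimately have "net F ?R < int (card (E \<inter> ?R \<times> (- ?R)))" by (intro small) auto
    moreover have "net F ?R = int (card (E \<inter> ?R \<times> (- ?R)))"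
    proof (rule net_saturated_cut)
      have step: "b \<in> ?R" if "a \<in> ?R" "(a, b) \<in> ?X" for a b
        using that by (auto intro: rtrancl_into_rtrancl)
      show "E \<inter> ?R \<times> (- ?R) \<subseteq> F" using step by blast
      show "F \<inter> (- ?R) \<times> ?R = {}" using step by blast
    qed (use assms finite_subset in auto)
    ultimately show False by simp
  qed
  from rtrancl_distinct_vwalk[OF this] augment_along_vwalk[OF assms(1,2)] show ?thesis
    by metis
qed

text \<open>Augment the zero flow twice, towards \<open>y\<close> and then towards \<open>z\<close>.  Augmenting never undoes the
  unit already arriving at \<open>y\<close>, so decomposing the result yields one path to each end.\<close>

lemma two_arc_disjoint_paths:
  assumes "finite V" "E \<subseteq> V \<times> V" "x \<in> V" "y \<in> V" "z \<in> V"
    and cut: "\<And>R. \<lbrakk>R \<subseteq> V; R \<noteq> {}; R \<noteq> V\<rbrakk> \<Longrightarrow> 2 \<le> card (E \<inter> R \<times> (- R))"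
  shows "\<exists>p q. p \<noteq> [] \<and> hd p = x \<and> last p = y \<and> distinct p \<and> set (vwalk_arcs p) \<subseteq> E \<and>
           q \<noteq> [] \<and> hd q = x \<and> last q = z \<and> distinct q \<and> set (vwalk_arcs q) \<subseteq> E \<and>
           set (vwalk_arcs p) \<inter> set (vwalk_arcs q) = {}"
proof -
  have fin: "finite E" using assms(1,2) finite_subset by blast
  have cut': "2 \<le> card (E \<inter> R \<times> (- R))"
    if "x \<in> R" "v \<notin> R" "R \<subseteq> insert x (Range E \<union> Domain E)" "v \<in> V" for R v
  proof (rule cut)
    show "R \<subseteq> V" using that(3) assms(2,3) by blast
  qed (use that in auto)
  have "\<exists>F\<subseteq>E. \<forall>R. net F R = net {} R + of_bool (x \<in> R) - of_bool (y \<in> R)"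
  proof (intro augment fin empty_subsetI)
    fix R assume "x \<in> R" "y \<notin> R" "R \<subseteq> insert x (Range E \<union> Domain E)"
    then have "2 \<le> card (E \<inter> R \<times> (- R))" using cut' assms(4) by blast
    then show "net {} R < int (card (E \<inter> R \<times> (- R)))" by (simp add: net_def)
  qed
  then obtain F where F: "F \<subseteq> E" "\<And>R. net F R = of_bool (x \<in> R) - of_bool (y \<in> R)"
    by (auto simp: net_def)
  have "\<exists>F'\<subseteq>E. \<forall>R. net F' R = net F R + of_bool (x \<in> R) - of_bool (z \<in> R)"
  proof (intro augment fin F(1))
    fix R assume "x \<in> R" "z \<notin> R" "R \<subseteq> insert x (Range E \<union> Domain E)"
    then have "2 \<le> card (E \<inter> R \<times> (- R))" using cut' assms(5) by blast
    \<comment> \<open>The first flow sends at most one unit out of \<open>R\<close>, while at least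
      two arcs leave \<open>R\<close>.\<close>
    then show "net F R < int (card (E \<inter> R \<times> (- R)))" using F(2)[of R] by (simp add: of_bool_def)
  qed
  then obtain G where G: "G \<subseteq> E"
      "\<And>R. net G R = 2 * of_bool (x \<in> R) - of_bool (y \<in> R) - of_bool (z \<in> R)"
    using F(2) by auto
  have finG: "finite G" using G(1) fin finite_subset by blast
  \<comment> \<open>Applied to the set reachable from \<open>x\<close>: if the target were missing,
    its net outflow would be at least 1, first for \<open>G\<close> with target \<open>y\<close>,
    then for the remainder \<open>?H\<close> with target \<open>z\<close>.\<close>
  have closed: "net H (H\<^sup>* `` {x}) \<le> 0" if "finite H" for H
    using that by (intro net_nonpos_if_closed) (auto intro: rtrancl_into_rtrancl)
  have "(x, y) \<in> G\<^sup>*" using closed[OF finG] G(2)[of "G\<^sup>* `` {x}"]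
    by (auto simp: of_bool_def split: if_splits)
  from rtrancl_distinct_vwalk[OF this] obtain p where
    p: "p \<noteq> []" "hd p = x" "last p = y" "distinct p" "set (vwalk_arcs p) \<subseteq> G" by blast
  let ?H = "G - set (vwalk_arcs p)"
  have "net ?H R = net G R - net (set (vwalk_arcs p)) R" for R
    unfolding net_def using p(5) finG by (simp add: sum_diff)
  then have "net ?H R = of_bool (x \<in> R) - of_bool (z \<in> R)" for R
    using G(2)[of R] net_vwalk[OF p(4,1), of R] p(2,3) by simp
  then have "(x, z) \<in> ?H\<^sup>*" using closed[of ?H] finG
    by (auto simp: of_bool_def split: if_splits)
  from rtrancl_distinct_vwalk[OF this] obtain q where
    q: "q \<noteq> []" "hd q = x" "last q = z" "distinct q" "set (vwalk_arcs q) \<subseteq> ?H" by blast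
  show ?thesis
    by (rule exI[of _ p], rule exI[of _ q]) (use p q G(1) in auto)
qed

section \<open>Vertices reached from, or reaching, all of a semicomplete set\<close>

text \<open>When \<open>v\<close> is added, an arc joins it to the old sink \<open>x\<close>: if it
  points to \<open>x\<close>, then \<open>x\<close> remains a sink, and otherwise \<open>v\<close>
  becomes one.\<close>

lemma semicomplete_sink:
  assumes "finite A" "A \<noteq> {}"
    and "\<And>a b. \<lbrakk>a \<in> A; b \<in> A; a \<noteq> b\<rbrakk> \<Longrightarrow> (a, b) \<in> E \<or> (b, a) \<in> E"
  shows "\<exists>x\<in>A. \<forall>a\<in>A. (a, x) \<in> (E \<inter> A \<times> A)\<^sup>*"
  using assms
proof (induction rule: finite_ne_induct)
  case (insert v A)
  then obtain x where x: "x \<in> A" "\<forall>a\<in>A. (a, x) \<in> (E \<inter> A \<times> A)\<^sup>*" by auto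
  let ?T = "E \<inter> insert v A \<times> insert v A"
  have "(E \<inter> A \<times> A)\<^sup>* \<subseteq> ?T\<^sup>*" by (intro rtrancl_mono) auto
  with x(2) have A: "\<forall>a\<in>A. (a, x) \<in> ?T\<^sup>*" by blast
  have "(v, x) \<in> ?T \<or> (x, v) \<in> ?T" using insert(5)[of v x] insert(3) x(1) by auto
  then show ?case
  proof
    assume "(v, x) \<in> ?T"
    with A x(1) show ?thesis by (intro bexI[of _ x]) auto
  next
    assume "(x, v) \<in> ?T"
    with A show ?thesis by (intro bexI[of _ v]) (auto intro: rtrancl_into_rtrancl)
  qed
qed auto

lemma semicomplete_source:
  assumes "finite A" "A \<noteq> {}"
    and "\<And>a b. \<lbrakk>a \<in> A; b \<in> A; a \<noteq> b\<rbrakk> \<Longrightarrow> (a, b) \<in> E \<or> (b, a) \<in> E"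
  shows "\<exists>x\<in>A. \<forall>a\<in>A. (x, a) \<in> (E \<inter> A \<times> A)\<^sup>*"
proof -
  have "(E\<inverse> \<inter> A \<times> A) = (E \<inter> A \<times> A)\<inverse>" by auto
  then show ?thesis using semicomplete_sink[of A "E\<inverse>"] assms
    by (auto simp: rtrancl_converse)
qed

section \<open>Two disjoint relations spanning from and towards the root\<close>

lemma ex_avoiding_at_most_one:
  assumes "2 \<le> card A" and "\<And>a b. \<lbrakk>a \<in> A; b \<in> A; P a; P b\<rbrakk> \<Longrightarrow> a = b"
  shows "\<exists>a\<in>A. \<not> P a"
proof (rule ccontr)
  assume "\<not> ?thesis"
  then have "card A \<le> Suc 0"
    using assms(2) card_ge_0_finite[of A] assms(1) by (subst card_le_Suc0_iff_eq) auto
  with assms(1) show False by simp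
qed

text \<open>If \<open>O'\<close> or \<open>I\<close> below is empty, then \<open>x\<close> or \<open>y\<close> degenerates to \<open>u\<close> and \<open>q'\<close> or \<open>p'\<close> to
  the single vertex \<open>u\<close>, so these cases need no separate treatment.\<close>

lemma arc_disjoint_spanning_relations:
  assumes "finite V" "E \<subseteq> V \<times> V" "S \<subseteq> V" "u \<in> S" "\<And>v. (v, v) \<notin> E"
    and semi: "\<And>a b. \<lbrakk>a \<in> S; b \<in> S; a \<noteq> b\<rbrakk> \<Longrightarrow> (a, b) \<in> E \<or> (b, a) \<in> E"
    and cut: "\<And>R. \<lbrakk>R \<subseteq> V; R \<noteq> {}; R \<noteq> V\<rbrakk> \<Longrightarrow> 2 \<le> card (E \<inter> R \<times> (- R))"
    and nbs: "\<And>w. w \<in> V - S \<Longrightarrow> 2 \<le> card {s\<in>S. (s, w) \<in> E} \<and> 2 \<le> card {s\<in>S. (w, s) \<in> E}"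
  shows "\<exists>X Y. X \<subseteq> E \<and> Y \<subseteq> E \<and> X \<inter> Y = {} \<and> (\<forall>v\<in>V. (u, v) \<in> X\<^sup>* \<and> (v, u) \<in> Y\<^sup>*)"
proof -
  define O' where "O' = {v\<in>S. (u, v) \<in> E}"
  define I where "I = S - O' - {u}"
  have u: "u \<notin> O'" "u \<notin> I" "u \<in> V" using assms by (auto simp: O'_def I_def)
  have S: "S = insert u (O' \<union> I)" "O' \<inter> I = {}" using assms(4) by (auto simp: O'_def I_def)
  have toO: "(u, v) \<in> E" if "v \<in> O'" for v using that by (simp add: O'_def)
  have fromI: "(v, u) \<in> E" if "v \<in> I" for v
    using that semi[of u v] assms(4) by (auto simp: O'_def I_def)
  have finS: "finite S" using assms(1,3) finite_subset by blast
  have "\<exists>x\<in>insert u O'. \<forall>v\<in>O'. (v, x) \<in> (E \<inter> O' \<times> O')\<^sup>*"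
    using semicomplete_sink[of O' E] semi finS S by (cases "O' = {}") auto
  then obtain x where x: "x \<in> insert u O'" "\<And>v. v \<in> O' \<Longrightarrow> (v, x) \<in> (E \<inter> O' \<times> O')\<^sup>*" by blast
  have "\<exists>y\<in>insert u I. (\<forall>v\<in>I. (y, v) \<in> (E \<inter> I \<times> I)\<^sup>*) \<and> (I \<noteq> {} \<longrightarrow> y \<in> I)"
    using semicomplete_source[of I E] semi finS S by (cases "I = {}") auto
  then obtain y where y: "y \<in> insert u I" "\<And>v. v \<in> I \<Longrightarrow> (y, v) \<in> (E \<inter> I \<times> I)\<^sup>*"
      "I \<noteq> {} \<Longrightarrow> y \<in> I" by blast
  have V: "x \<in> V" "y \<in> V" using x(1) y(1) S assms(3) by auto
  from two_arc_disjoint_paths[OF assms(1,2) V u(3) cut] obtain p0 q0 where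
    p0: "p0 \<noteq> []" "hd p0 = x" "last p0 = y" "distinct p0" "set (vwalk_arcs p0) \<subseteq> E" and
    q0: "q0 \<noteq> []" "hd q0 = x" "last q0 = u" "distinct q0" "set (vwalk_arcs q0) \<subseteq> E" and
    pq0: "set (vwalk_arcs p0) \<inter> set (vwalk_arcs q0) = {}"
    by blast
  have "\<exists>a\<in>set p0. a \<in> insert u O'" using p0(1,2) x(1) hd_in_set by metis
  from split_list_last_prop[OF this] obtain p1 a p2 where
    p: "p0 = p1 @ a # p2" "a \<in> insert u O'" "\<forall>b\<in>set p2. b \<notin> insert u O'" by blast
  have "\<exists>b\<in>set q0. b \<in> insert u I" using q0(1,3) last_in_set by fastforce
  from split_list_first_prop[OF this] obtain q1 b q2 where
    q: "q0 = q1 @ b # q2" "b \<in> insert u I" "\<forall>c\<in>set q1. c \<notin> insert u I" by blast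
  define p' where "p' = a # p2"
  define q' where "q' = q1 @ [b]"
  have P_sub: "set (vwalk_arcs p') \<subseteq> set (vwalk_arcs p0)"
    unfolding p(1) p'_def by (rule vwalk_arcs_append_subset)
  have Q_sub: "set (vwalk_arcs q') \<subseteq> set (vwalk_arcs q0)"
    using vwalk_arcs_prefix_subset[of "q1 @ [b]" q2] unfolding q(1) q'_def by simp
  have PE: "set (vwalk_arcs p') \<subseteq> E" and QE: "set (vwalk_arcs q') \<subseteq> E"
    and PQ: "set (vwalk_arcs p') \<inter> set (vwalk_arcs q') = {}"
    using P_sub Q_sub p0(5) q0(5) pq0 by auto
  have dist: "distinct p'" "distinct q'" using p0(4) q0(4) by (auto simp: p q p'_def q'_def)
  \<comment> \<open>This is the purpose of the cuts. No arc of \<open>p'\<close> ends in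
    \<open>O'\<close> or \<open>u\<close>, so \<open>p'\<close> avoids \<open>I \<times> {u}\<close>
    and the arcs inside \<open>O'\<close>; no arc of \<open>q'\<close> starts in \<open>I\<close> or
    \<open>u\<close>, so \<open>q'\<close> avoids \<open>{u} \<times> O'\<close> and the arcs inside
    \<open>I\<close>.\<close>
  have P_head: "d \<notin> insert u O'" if "(c, d) \<in> set (vwalk_arcs p')" for c d
    using vwalk_arcs_ends[OF that] p(3) by (auto simp: p'_def)
  have Q_tail: "c \<notin> insert u I" if "(c, d) \<in> set (vwalk_arcs q')" for c d
    using vwalk_arcs_ends[OF that] q(3) by (auto simp: q'_def)
  have last_p: "last p' = y" using p0(3) by (simp add: p(1) p'_def)
  have hd_q: "hd q' = x" using q0(2) by (cases q1) (simp_all add: q(1) q'_def)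
  have "\<exists>f. \<forall>w\<in>V - S. f w \<in> S \<and> (f w, w) \<in> E \<and> (f w, w) \<notin> set (vwalk_arcs q')"
  proof (intro bchoice ballI)
    fix w assume w: "w \<in> V - S"
    have "\<exists>s\<in>{s\<in>S. (s, w) \<in> E}. (s, w) \<notin> set (vwalk_arcs q')"
      by (rule ex_avoiding_at_most_one) (use nbs[OF w] vwalk_arcs_unique_in[OF dist(2)] in auto)
    then show "\<exists>s. s \<in> S \<and> (s, w) \<in> E \<and> (s, w) \<notin> set (vwalk_arcs q')" by auto
  qed
  then obtain f where f: "\<And>w. w \<in> V - S \<Longrightarrow>
      f w \<in> S \<and> (f w, w) \<in> E \<and> (f w, w) \<notin> set (vwalk_arcs q')" by auto
  have "\<exists>g. \<forall>w\<in>V - S. g w \<in> S \<and> (w, g w) \<in> E \<and> (w, g w) \<notin> set (vwalk_arcs p')"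
  proof (intro bchoice ballI)
    fix w assume w: "w \<in> V - S"
    have "\<exists>s\<in>{s\<in>S. (w, s) \<in> E}. (w, s) \<notin> set (vwalk_arcs p')"
      by (rule ex_avoiding_at_most_one) (use nbs[OF w] vwalk_arcs_unique_out[OF dist(1)] in auto)
    then show "\<exists>s. s \<in> S \<and> (w, s) \<in> E \<and> (w, s) \<notin> set (vwalk_arcs p')" by auto
  qed
  then obtain g where g: "\<And>w. w \<in> V - S \<Longrightarrow>
      g w \<in> S \<and> (w, g w) \<in> E \<and> (w, g w) \<notin> set (vwalk_arcs p')" by auto
  define X where "X = {u} \<times> O' \<union> set (vwalk_arcs p') \<union> (E \<inter> I \<times> I) \<union>
      {(f w, w) |w. w \<in> V - S - set p'}"
  define Y where "Y = I \<times> {u} \<union> set (vwalk_arcs q') \<union> (E \<inter> O' \<times> O') \<union>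
      {(w, g w) |w. w \<in> V - S - set q'}"
  have XE: "X \<subseteq> E" using toO PE f by (auto simp: X_def)
  have YE: "Y \<subseteq> E" using fromI QE g by (auto simp: Y_def)
  have disj: "e \<notin> Y" if "e \<in> X" for e
  proof -
    obtain c d where e: "e = (c, d)" by (cases e)
    from that consider "c = u" "d \<in> O'" | "(c, d) \<in> set (vwalk_arcs p')" | "c \<in> I" "d \<in> I"
      | "c = f d" "d \<in> V - S" by (auto simp: X_def e)
    then show ?thesis
    proof cases
      case 1
      then show ?thesis using u S Q_tail[of c d] by (auto simp: Y_def e)
    next
      case 2
      then show ?thesis using P_head[OF 2] PQ g[of c] by (auto simp: Y_def e)
    next
      case 3
      then show ?thesis using u S Q_tail[of c d] by (auto simp: Y_def e)
    next
      \<comment> \<open>Leaf arcs of \<open>X\<close> run from \<open>S\<close> to its complement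
        and those of \<open>Y\<close> run the other way, so they never coincide; the choice of
        \<open>f\<close> excludes \<open>q'\<close>, and all other arcs of \<open>Y\<close> stay
        inside \<open>S\<close>.\<close>
      case 4
      then show ?thesis using S f[of d] g[of c] by (auto simp: Y_def e)
    qed
  qed
  have out: "(u, v) \<in> X\<^sup>*" if "v \<in> V" for v
  proof -
    \<comment> \<open>Reachability spreads from \<open>O'\<close> along \<open>p'\<close> to its end
      \<open>y\<close>, from there through \<open>I\<close>, and finally from \<open>S\<close> to
      the leaves.\<close>
    have O: "(u, w) \<in> X\<^sup>*" if "w \<in> insert u O'" for w using that by (auto simp: X_def)
    have P: "(u, w) \<in> X\<^sup>*" if "w \<in> set p'" for w
    proof -
      have "(a, w) \<in> X\<^sup>*" using rtrancl_hd_vwalk[OF _ that, of X] by (auto simp: X_def p'_def)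
      with O[OF p(2)] show ?thesis by (rule rtrancl_trans)
    qed
    have I: "(u, w) \<in> X\<^sup>*" if "w \<in> I" for w
    proof -
      have "(E \<inter> I \<times> I)\<^sup>* \<subseteq> X\<^sup>*" by (rule rtrancl_mono) (auto simp: X_def)
      with y(2)[OF that] have "(y, w) \<in> X\<^sup>*" by blast
      moreover have "y \<in> set p'" using last_p by (auto simp: p'_def split: if_splits)
      ultimately show ?thesis using P rtrancl_trans by fast
    qed
    have S': "(u, w) \<in> X\<^sup>*" if "w \<in> S" for w using that O I S by auto
    show ?thesis
    proof (cases "v \<in> S \<or> v \<in> set p'")
      case False
      with that have "(f v, v) \<in> X" by (auto simp: X_def)
      moreover have "(u, f v) \<in> X\<^sup>*" using S' f False that by auto
      ultimately show ?thesis by (rule rtrancl_into_rtrancl[rotated])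
    qed (use S' P in auto)
  qed
  have into: "(v, u) \<in> Y\<^sup>*" if "v \<in> V" for v
  proof -
    have I: "(w, u) \<in> Y\<^sup>*" if "w \<in> insert u I" for w using that by (auto simp: Y_def)
    have Q: "(w, u) \<in> Y\<^sup>*" if "w \<in> set q'" for w
    proof -
      have "(w, b) \<in> Y\<^sup>*" using rtrancl_vwalk_last[OF _ that, of Y] by (auto simp: Y_def q'_def)
      then show ?thesis using I[OF q(2)] by (rule rtrancl_trans)
    qed
    have O: "(w, u) \<in> Y\<^sup>*" if "w \<in> O'" for w
    proof -
      have "(E \<inter> O' \<times> O')\<^sup>* \<subseteq> Y\<^sup>*" by (rule rtrancl_mono) (auto simp: Y_def)
      with x(2)[OF that] have "(w, x) \<in> Y\<^sup>*" by blast
      moreover have "x \<in> set q'" using hd_q hd_in_set[of q'] by (auto simp: q'_def)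
      ultimately show ?thesis using Q rtrancl_trans by fast
    qed
    have S': "(w, u) \<in> Y\<^sup>*" if "w \<in> S" for w using that O I S by auto
    show ?thesis
    proof (cases "v \<in> S \<or> v \<in> set q'")
      case False
      with that have "(v, g v) \<in> Y" by (auto simp: Y_def)
      moreover have "(g v, u) \<in> Y\<^sup>*" using S' g False that by auto
      ultimately show ?thesis by (rule converse_rtrancl_into_rtrancl)
    qed (use S' Q in auto)
  qed
  from disj have "X \<inter> Y = {}" by auto
  with XE YE out into show ?thesis
    by (intro exI[of _ X] exI[of _ Y]) simp
qed

section \<open>From spanning relations to branchings\<close>

text \<open>\<open>level\<close> is the distance from \<open>r\<close>, and \<open>par v\<close> is
  the predecessor of \<open>v\<close> on a shortest walk.\<close>

lemma breadth_first_parents: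
  assumes "\<forall>v\<in>V. (r, v) \<in> X\<^sup>*"
  obtains par :: "'a \<Rightarrow> 'a" and level :: "'a \<Rightarrow> nat"
  where "\<And>v. \<lbrakk>v \<in> V; v \<noteq> r\<rbrakk> \<Longrightarrow> (par v, v) \<in> X \<and> level (par v) < level v"
proof -
  define level where "level v = (LEAST n. (r, v) \<in> X ^^ n)" for v
  have "\<exists>w. (w, v) \<in> X \<and> level w < level v" if vr: "v \<in> V" "v \<noteq> r" for v
  proof -
    have "\<exists>n. (r, v) \<in> X ^^ n" using assms vr(1) rtrancl_power by metis
    then have v: "(r, v) \<in> X ^^ level v" unfolding level_def by (rule LeastI_ex)
    then obtain n where n: "level v = Suc n" using vr(2) by (cases "level v") auto
    with v obtain w where w: "(r, w) \<in> X ^^ n" "(w, v) \<in> X" by auto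
    then have "level w \<le> n" unfolding level_def by (intro Least_le)
    with w n show ?thesis by auto
  qed
  then show ?thesis using that by metis
qed

text \<open>The edge between \<open>v\<close> and \<open>par v\<close> may point either way, so that
  the lemma serves both out- and in-branchings. Descending levels give connectedness by induction
  and exclude cycles.\<close>

lemma oriented_tree_if_parents:
  fixes T :: "('a, 'b) pre_digraph" and level :: "'a \<Rightarrow> nat"
  assumes "digraph T" "r \<in> verts T"
    and par: "\<And>v. \<lbrakk>v \<in> verts T; v \<noteq> r\<rbrakk> \<Longrightarrow> par v \<in> verts T \<and> level (par v) < level v"
    and arc: "\<And>v w. v \<rightarrow>\<^bsub>T\<^esub> w \<Longrightarrow> w \<noteq> r \<and> v = par w \<or> v \<noteq> r \<and> w = par v"
    and ex: "\<And>v. \<lbrakk>v \<in> verts T; v \<noteq> r\<rbrakk> \<Longrightarrow> par v \<rightarrow>\<^bsub>T\<^esub> v \<or> v \<rightarrow>\<^bsub>T\<^esub> par v"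
    and antisym: "\<And>v w. \<lbrakk>v \<rightarrow>\<^bsub>T\<^esub> w; w \<rightarrow>\<^bsub>T\<^esub> v\<rbrakk> \<Longrightarrow> False"
  shows "oriented_tree T"
proof -
  interpret T: digraph T by fact
  let ?M = "mk_symmetric T"
  interpret M: pair_digraph ?M by (rule T.digraph_mk_symmetric)
  have parcs: "(v, w) \<in> parcs ?M \<longleftrightarrow> v \<rightarrow>\<^bsub>T\<^esub> w \<or> w \<rightarrow>\<^bsub>T\<^esub> v" for v w
    by (auto simp: parcs_mk_symmetric arcs_ends_conv)
  have root: "(v, r) \<in> (parcs ?M)\<^sup>*" if "v \<in> verts T" for v
    using that
  proof (induction "level v" arbitrary: v rule: less_induct)
    case less
    show ?case
    proof (cases "v = r")
      case False
      then have "(v, par v) \<in> parcs ?M" using ex less.prems parcs by blast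
      moreover have "(par v, r) \<in> (parcs ?M)\<^sup>*" using less par False by blast
      ultimately show ?thesis by (rule converse_rtrancl_into_rtrancl)
    qed simp
  qed
  have "sym (parcs ?M)" by (auto simp: sym_def parcs)
  then have "(r, v) \<in> (parcs ?M)\<^sup>*" if "v \<in> verts T" for v
    using root[OF that] by (meson sym_rtrancl symD)
  then have "v \<rightarrow>\<^sup>*\<^bsub>?M\<^esub> w" if "v \<in> verts T" "w \<in> verts T" for v w
    using M.reachable_conv'[of v w] root that by (auto intro: rtrancl_trans)
  then have conn: "Digraph_Component.connected T"
    unfolding connected_def strongly_connected_def using assms(2) by auto
  \<comment> \<open>Since \<open>par\<close> strictly lowers the level, \<open>v\<close> cannot be
    the parent of a vertex that is no higher.\<close>
  have up: "v \<noteq> r \<and> w = par v" if "(v, w) \<in> parcs ?M" "level w \<le> level v" for v w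
  proof -
    have "v \<in> verts T" "w \<in> verts T" using that(1) M.in_arcsD1 M.in_arcsD2 by auto
    moreover have "w \<noteq> r \<and> v = par w \<or> v \<noteq> r \<and> w = par v" using that(1) parcs arc by blast
    ultimately show ?thesis using par[of w] that(2) by auto
  qed
  text \<open>Both neighbours of a vertex of maximal level on a cycle are its parent.\<close>
  have acyc: False if c: "3 \<le> length c" "pre_digraph.cycle (with_proj ?M) c" for c
  proof -
    from c(2) obtain s where s: "M.awalk s c s" "distinct (tl (pawalk_verts s c))" "c \<noteq> []"
      by (auto simp: pre_digraph.cycle_def awalk_verts_with_proj_eq)
    have cas: "pcas s c s" and sub: "set c \<subseteq> parcs ?M" using s(1) by (auto simp: M.awalk_def)
    have heads: "distinct (map snd c)" using s(2) M.awalk_verts_conv'[OF cas] s(3) by simp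
    let ?n = "length c"
    have chain: "fst (c ! Suc i) = snd (c ! i)" if "Suc i < ?n" for i
    proof -
      have "fst (es ! Suc j) = snd (es ! j)" if "pcas s' es t" "Suc j < length es"
        for s' es and t :: 'a and j
        using that
      proof (induction es arbitrary: s' j)
        case (Cons e es)
        show ?case
        proof (cases j)
          case 0
          with Cons.prems show ?thesis by (cases es) auto
        next
          case (Suc k)
          with Cons.IH[of "snd e" k] Cons.prems show ?thesis by simp
        qed
      qed simp
      from this[OF cas that] show ?thesis .
    qed
    have close: "fst (c ! 0) = snd (c ! (?n - 1))"
    proof -
      have "snd (last es) = t \<and> fst (hd es) = s'" if "pcas s' es t" "es \<noteq> []" for s' es and t :: 'a
        using that by (induction es arbitrary: s') (auto simp: neq_Nil_conv)
      from this[OF cas s(3)] show ?thesis using s(3) by (simp add: hd_conv_nth last_conv_nth)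
    qed
    \<comment> \<open>The vertices of the cycle, indexed periodically so that neighbours need no
      wrap-around case.\<close>
    define h where "h i = snd (c ! (i mod ?n))" for i
    have n: "0 < ?n" using s(3) by simp
    have edge: "(h i, h (Suc i)) \<in> parcs ?M" for i
    proof -
      have "c ! (Suc i mod ?n) = (h i, h (Suc i))"
      proof (cases "Suc (i mod ?n) = ?n")
        case True
        then have "Suc i mod ?n = 0" by (simp add: mod_Suc)
        moreover have "i mod ?n = ?n - 1" using True by simp
        ultimately show ?thesis using close by (simp add: h_def prod_eq_iff)
      next
        case False
        then have "Suc i mod ?n = Suc (i mod ?n)" by (simp add: mod_Suc)
        moreover have "Suc (i mod ?n) < ?n" using False n mod_less_divisor[of ?n i] by linarith
        ultimately show ?thesis using chain by (simp add: h_def prod_eq_iff)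
      qed
      then show ?thesis using sub n by (metis mod_less_divisor nth_mem subsetD)
    qed
    obtain k where k: "k < ?n" "\<And>i. i < ?n \<Longrightarrow> level (h i) \<le> level (h k)"
    proof -
      let ?L = "(\<lambda>i. level (h i)) ` {..<?n}"
      have "Max ?L \<in> ?L" using n by (intro Max_in) auto
      then obtain k where "k < ?n" "level (h k) = Max ?L" by auto
      then show ?thesis using that[of k] by simp
    qed
    have max: "level (h i) \<le> level (h k)" for i
      using k(2)[of "i mod ?n"] n by (simp add: h_def)
    \<comment> \<open>The index before \<open>k\<close> modulo \<open>?n\<close>, written so that
      natural subtraction cannot truncate at \<open>k = 0\<close>.\<close>
    let ?j = "k + (?n - 1)"
    have "Suc ?j = k + ?n" using n by simp
    moreover have "h (k + ?n) = h k" by (simp add: h_def)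
    ultimately have j: "h (Suc ?j) = h k" by (simp only:)
    have "(h k, h ?j) \<in> parcs ?M" using edge[of ?j] j parcs by auto
    then have "h ?j = par (h k)" using up max by blast
    moreover have "h (Suc k) = par (h k)" using up edge max by blast
    ultimately have "h ?j = h (Suc k)" by simp
    moreover have "h i = map snd c ! (i mod ?n)" for i using n by (simp add: h_def)
    ultimately have "map snd c ! (?j mod ?n) = map snd c ! (Suc k mod ?n)" by metis
    then have "?j mod ?n = Suc k mod ?n" 
      by (rule nth_eq_iff_index_eq[OF heads, THEN iffD1, rotated 2]) (simp_all add: s(3))
    moreover have "Suc k \<le> ?j" using c(1) by simp
    ultimately have "?n dvd ?j - Suc k" by (simp only: mod_eq_dvd_iff_nat)
    \<comment> \<open>The two cycle neighbours of \<open>h k\<close> coincide, so their indices are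
      congruent, yet they differ by \<open>?n - 2\<close>. Length at least 3 makes this difference
      positive and less than \<open>?n\<close>.\<close>
    then have "?n dvd ?n - 2" using c(1) by (simp add: numeral_2_eq_2)
    then show False using c(1) by (auto dest: dvd_imp_le)
  qed
  show ?thesis
    unfolding oriented_tree_def using assms(1) antisym conn acyc by blast
qed

lemma digraph_restrict_arcs:
  assumes "digraph D" "A \<subseteq> arcs D"
  shows "digraph (D\<lparr>arcs := A\<rparr>)"
proof -
  interpret D: digraph D by fact
  show ?thesis
    by unfold_locales
      (use assms(2) finite_subset[OF assms(2)] D.no_loops in
        \<open>auto simp: arc_to_ends_def intro: D.no_multi_arcs\<close>)
qed

lemma arcs_ends_restrict:
  "(v, w) \<in> arcs_ends (D\<lparr>arcs := {e \<in> arcs D. P (tail D e) (head D e)}\<rparr>) \<longleftrightarrow>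
    (v, w) \<in> arcs_ends D \<and> P v w"
  by (auto simp: arcs_ends_conv)

text \<open>The arcs from breadth-first parents inside \<open>X\<close> form the branching.
  Recording that \<open>B\<close> keeps the end maps of \<open>D\<close> lets disjointness of end
  pairs yield disjointness of arcs.\<close>

lemma ex_out_branching:
  assumes "digraph D" "r \<in> verts D" "X \<subseteq> arcs_ends D" "\<forall>v\<in>verts D. (r, v) \<in> X\<^sup>*"
  shows "\<exists>B. out_branching D r B \<and> arcs_ends B \<subseteq> X \<and> arcs B \<subseteq> arcs D \<and>
    tail B = tail D \<and> head B = head D"
proof -
  interpret D: digraph D by fact
  obtain par and level :: "'a \<Rightarrow> nat"
    where par: "\<And>v. \<lbrakk>v \<in> verts D; v \<noteq> r\<rbrakk> \<Longrightarrow> (par v, v) \<in> X \<and> level (par v) < level v"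
    using breadth_first_parents[OF assms(4)] by blast
  define B where "B = D\<lparr>arcs := {e \<in> arcs D. head D e \<noteq> r \<and> tail D e = par (head D e)}\<rparr>"
  have B: "verts B = verts D" "tail B = tail D" "head B = head D" "arcs B \<subseteq> arcs D"
    by (auto simp: B_def)
  have arc: "(v, w) \<in> arcs_ends B \<longleftrightarrow> w \<in> verts D \<and> w \<noteq> r \<and> v = par w" for v w
  proof -
    have "(par w, w) \<in> arcs_ends D" if "w \<in> verts D" "w \<noteq> r"
      using par[OF that] assms(3) by blast
    moreover have "(v, w) \<in> arcs_ends B \<longleftrightarrow> (v, w) \<in> arcs_ends D \<and> w \<noteq> r \<and> v = par w"
      unfolding B_def by (rule arcs_ends_restrict[of v w D "\<lambda>v w. w \<noteq> r \<and> v = par w"])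
    ultimately show ?thesis using D.adj_in_verts by blast
  qed
  have par_in: "par v \<in> verts D" if "v \<in> verts D" "v \<noteq> r" for v
    using par[OF that] assms(3) D.adj_in_verts by blast
  interpret B: digraph B unfolding B_def by (rule digraph_restrict_arcs[OF assms(1)]) auto
  have "oriented_tree B"
  proof (rule oriented_tree_if_parents[where par = par and level = level and r = r])
    show "digraph B" by unfold_locales
    show "False" if "v \<rightarrow>\<^bsub>B\<^esub> w" "w \<rightarrow>\<^bsub>B\<^esub> v" for v w
      using that par[of v] par[of w] unfolding arc by auto
  qed (use assms(2) par par_in arc B(1) in auto)
  moreover have "in_degree B v = 1" if "v \<in> verts B - {r}" for v
  proof -
    have "par v \<rightarrow>\<^bsub>B\<^esub> v" using that B(1) arc by auto
    then obtain e where e: "e \<in> arcs B" "tail B e = par v" "head B e = v" by blast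
    \<comment> \<open>The tail of an arc into \<open>v\<close> must be \<open>par v\<close>, and
      parallel arcs are excluded.\<close>
    have "e' = e" if "e' \<in> in_arcs B v" for e'
    proof (rule B.no_multi_arcs)
      have "tail B e' \<rightarrow>\<^bsub>B\<^esub> v" using that by (auto simp: arcs_ends_conv)
      then show "arc_to_ends B e' = arc_to_ends B e"
        using e that by (simp add: arc arc_to_ends_def)
    qed (use e that in auto)
    moreover have "e \<in> in_arcs B v" using e by simp
    ultimately have "in_arcs B v = {e}" by blast
    then show ?thesis by (simp add: in_degree_def)
  qed
  moreover have "spanning B D"
    using B D.wf_digraph B.wf_digraph by (auto simp: spanning_def subgraph_def compatible_def)
  ultimately have "out_branching D r B" using assms(2) B(1) by (auto simp: out_branching_def)
  moreover have "arcs_ends B \<subseteq> X" using arc par by auto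
  ultimately show ?thesis using B by blast
qed

text \<open>Breadth-first search along \<open>X\<inverse>\<close> makes \<open>par v\<close> the
  next vertex on a shortest walk to \<open>r\<close>.\<close>

lemma ex_in_branching:
  assumes "digraph D" "r \<in> verts D" "X \<subseteq> arcs_ends D" "\<forall>v\<in>verts D. (v, r) \<in> X\<^sup>*"
  shows "\<exists>B. in_branching D r B \<and> arcs_ends B \<subseteq> X \<and> arcs B \<subseteq> arcs D \<and>
    tail B = tail D \<and> head B = head D"
proof -
  interpret D: digraph D by fact
  have "\<forall>v\<in>verts D. (r, v) \<in> (X\<inverse>)\<^sup>*" using assms(4) by (simp add: rtrancl_converse)
  then obtain par and level :: "'a \<Rightarrow> nat"
    where par: "\<And>v. \<lbrakk>v \<in> verts D; v \<noteq> r\<rbrakk> \<Longrightarrow> (v, par v) \<in> X \<and> level (par v) < level v"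
    using breadth_first_parents[of "verts D" r "X\<inverse>"] by (metis converse_iff)
  define B where "B = D\<lparr>arcs := {e \<in> arcs D. tail D e \<noteq> r \<and> head D e = par (tail D e)}\<rparr>"
  have B: "verts B = verts D" "tail B = tail D" "head B = head D" "arcs B \<subseteq> arcs D"
    by (auto simp: B_def)
  have arc: "(v, w) \<in> arcs_ends B \<longleftrightarrow> v \<in> verts D \<and> v \<noteq> r \<and> w = par v" for v w
  proof -
    have "(v, par v) \<in> arcs_ends D" if "v \<in> verts D" "v \<noteq> r"
      using par[OF that] assms(3) by blast
    moreover have "(v, w) \<in> arcs_ends B \<longleftrightarrow> (v, w) \<in> arcs_ends D \<and> v \<noteq> r \<and> w = par v"
      unfolding B_def by (rule arcs_ends_restrict[of v w D "\<lambda>v w. v \<noteq> r \<and> w = par v"])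
    ultimately show ?thesis using D.adj_in_verts by blast
  qed
  have par_in: "par v \<in> verts D" if "v \<in> verts D" "v \<noteq> r" for v
    using par[OF that] assms(3) D.adj_in_verts by blast
  interpret B: digraph B unfolding B_def by (rule digraph_restrict_arcs[OF assms(1)]) auto
  have "oriented_tree B"
  proof (rule oriented_tree_if_parents[where par = par and level = level and r = r])
    show "digraph B" by unfold_locales
    show "False" if "v \<rightarrow>\<^bsub>B\<^esub> w" "w \<rightarrow>\<^bsub>B\<^esub> v" for v w
      using that par[of v] par[of w] unfolding arc by auto
  qed (use assms(2) par par_in arc B(1) in auto)
  moreover have "out_degree B v = 1" if "v \<in> verts B - {r}" for v
  proof -
    have "v \<rightarrow>\<^bsub>B\<^esub> par v" using that B(1) arc by auto
    then obtain e where e: "e \<in> arcs B" "tail B e = v" "head B e = par v" by blast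
    have "e' = e" if "e' \<in> out_arcs B v" for e'
    proof (rule B.no_multi_arcs)
      have "v \<rightarrow>\<^bsub>B\<^esub> head B e'" using that by (auto simp: arcs_ends_conv)
      then show "arc_to_ends B e' = arc_to_ends B e"
        using e that by (simp add: arc arc_to_ends_def)
    qed (use e that in auto)
    moreover have "e \<in> out_arcs B v" using e by simp
    ultimately have "out_arcs B v = {e}" by blast
    then show ?thesis by (simp add: out_degree_def)
  qed
  moreover have "spanning B D"
    using B D.wf_digraph B.wf_digraph by (auto simp: spanning_def subgraph_def compatible_def)
  ultimately have "in_branching D r B" using assms(2) B(1) by (auto simp: in_branching_def)
  moreover have "arcs_ends B \<subseteq> X" using arc par by auto
  ultimately show ?thesis using B by blast
qed

section \<open>Cuts in 2-arc-strong digraphs and the good pair\<close>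

text \<open>Deleting all arcs that leave \<open>R\<close> destroys strong connectivity, so there
  must be at least two of them.\<close>

lemma arc_strong_2_cut:
  assumes "digraph D" "arc_strong 2 D" "R \<subseteq> verts D" "R \<noteq> {}" "R \<noteq> verts D"
  shows "2 \<le> card (arcs_ends D \<inter> R \<times> (- R))"
proof (rule ccontr)
  assume less: "\<not> ?thesis"
  interpret D: digraph D by fact
  let ?F = "{e \<in> arcs D. tail D e \<in> R \<and> head D e \<notin> R}"
  have "arc_to_ends D ` ?F = arcs_ends D \<inter> R \<times> (- R)"
    by (auto simp: arcs_ends_def arc_to_ends_def)
  \<comment> \<open>Without parallel arcs, counting end pairs is the same as counting arcs.\<close>
  moreover have "card (arc_to_ends D ` ?F) = card ?F"
    by (rule card_image, rule inj_on_subset[OF D.inj_on_arc_to_ends]) auto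
  ultimately have "card ?F < 2" using less by simp
  then have str: "strongly_connected (delete_arcs D ?F)"
    using assms(2) unfolding arc_strong_def by auto
  obtain x y where xy: "x \<in> R" "y \<in> verts D" "y \<notin> R" using assms(3-5) by blast
  then have "x \<rightarrow>\<^sup>*\<^bsub>delete_arcs D ?F\<^esub> y"
    using str assms(3) by (auto simp: strongly_connected_def delete_arcs_def)
  then have "(x, y) \<in> (arcs_ends (delete_arcs D ?F))\<^sup>*" by (rule reachable_rtranclI)
  then have "y \<in> R"
    by induction (use xy(1) in \<open>auto simp: arcs_ends_conv delete_arcs_def\<close>)
  with xy(3) show False by simp
qed

theorem theorem4p5:
  fixes D S :: "('a, 'b) pre_digraph" and u :: 'a
  assumes "digraph D"
    and "arc_strong 2 D"
    and "u \<in> verts D"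
    and "induced_subgraph S D"
    and "semicomplete S"
    and "u \<in> verts S"
    and "\<And>x. x \<in> verts D - verts S \<Longrightarrow>
      2 \<le> card (in_neighbours D x \<inter> verts S) \<and> 2 \<le> card (out_neighbours D x \<inter> verts S)"
  shows "has_good_pair D u u"
proof -
  interpret D: digraph D by fact
  have sub: "subgraph S D" using assms(4) by (rule induced_imp_subgraph)
  have VS: "verts S \<subseteq> verts D" using sub by (rule subgraph_imp_subverts)
  have "\<exists>X Y. X \<subseteq> arcs_ends D \<and> Y \<subseteq> arcs_ends D \<and> X \<inter> Y = {} \<and>
      (\<forall>v\<in>verts D. (u, v) \<in> X\<^sup>* \<and> (v, u) \<in> Y\<^sup>*)"
  proof (rule arc_disjoint_spanning_relations[OF _ _ VS assms(6)])
    show "arcs_ends D \<subseteq> verts D \<times> verts D" using D.adj_in_verts by auto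
    show "(v, v) \<notin> arcs_ends D" for v using D.adj_not_same by blast
    show "(a, b) \<in> arcs_ends D \<or> (b, a) \<in> arcs_ends D"
      if "a \<in> verts S" "b \<in> verts S" "a \<noteq> b" for a b
      using that assms(5) arcs_ends_mono[OF sub] by (auto simp: semicomplete_def)
    show "2 \<le> card (arcs_ends D \<inter> R \<times> (- R))" if "R \<subseteq> verts D" "R \<noteq> {}" "R \<noteq> verts D" for R
      using arc_strong_2_cut[OF assms(1,2) that] .
    show "2 \<le> card {s \<in> verts S. (s, w) \<in> arcs_ends D} \<and> 2 \<le> card {s \<in> verts S. (w, s) \<in> arcs_ends D}"
      if "w \<in> verts D - verts S" for w
    proof -
      have "in_neighbours D w \<inter> verts S = {s \<in> verts S. (s, w) \<in> arcs_ends D}"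
        "out_neighbours D w \<inter> verts S = {s \<in> verts S. (w, s) \<in> arcs_ends D}"
        using VS by (auto simp: in_neighbours_def out_neighbours_def)
      with assms(7)[OF that] show ?thesis by simp
    qed
  qed simp
  then obtain X Y where XY: "X \<subseteq> arcs_ends D" "Y \<subseteq> arcs_ends D" "X \<inter> Y = {}"
    "\<forall>v\<in>verts D. (u, v) \<in> X\<^sup>*" "\<forall>v\<in>verts D. (v, u) \<in> Y\<^sup>*" by blast
  from ex_out_branching[OF assms(1,3) XY(1,4)] obtain B\<^sub>o where
    Bo: "out_branching D u B\<^sub>o" "arcs_ends B\<^sub>o \<subseteq> X" "tail B\<^sub>o = tail D" "head B\<^sub>o = head D" by blast
  from ex_in_branching[OF assms(1,3) XY(2,5)] obtain B\<^sub>i where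
    Bi: "in_branching D u B\<^sub>i" "arcs_ends B\<^sub>i \<subseteq> Y" "tail B\<^sub>i = tail D" "head B\<^sub>i = head D" by blast
  \<comment> \<open>A common arc would have its end pair in both \<open>X\<close> and
    \<open>Y\<close>, as both branchings use the end maps of \<open>D\<close>.\<close>
  have "arcs B\<^sub>o \<inter> arcs B\<^sub>i = {}" using Bo(2-4) Bi(2-4) XY(3) by (auto simp: arcs_ends_conv)
  with Bo(1) Bi(1) show ?thesis unfolding has_good_pair_def by blast
qed

end
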